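(* Let $\tilde\beta\in\mathbb{R}$ with $|\tilde\beta|<1$, let $\sigma>0$ be a constant, and consider on $\mathbb{R}^2$ the constant-coefficient corner layer equation $$\mathrm{i}\,\partial_t u+\left(D_x^2+D_y^2+\tilde\beta D_xD_y\right)u=0,\qquad D_x=\frac{1}{1+e^{\mathrm{i}\pi/4}\sigma}\left(\partial_x-e^{\mathrm{i}\pi/4}\frac{\tilde\beta}{2}\sigma\,\partial_y\right),\quad D_y=\frac{1}{1+e^{\mathrm{i}\pi/4}\sigma}\left(\partial_y-e^{\mathrm{i}\pi/4}\frac{\tilde\beta}{2}\sigma\,\partial_x\right).$$ Set, for $0<b<1$, $$\sigma_1(b)=\frac{\sqrt2}{4b}\left(2-b+\sqrt{b^2+12b+4}\right),$$ and $\sigma_1(0)=+\infty$. If $0<\sigma<\sigma_1(|\tilde\beta|)$, then the equation is stable, i.e. its Fourier growth rate $\nu$ satisfies $\mathrm{Re}\,\nu(k_x,k_y)\le 0$ for all $(k_x,k_y)\in\mathbb{R}^2$. In particular, for $\tilde\beta=0$ the equation is stable for every $\sigma>0$.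
   Context: The Fourier growth rate $\nu(k_x,k_y)$ is the complex number such that taking the Fourier transform in $(x,y)$ with dual variables $(k_x,k_y)\in\mathbb{R}^2$ (so that $\partial_x\to \mathrm{i}k_x$, $\partial_y\to\mathrm{i}k_y$) turns the equation into $\partial_t\hat u=\nu(k_x,k_y)\hat u$. Stability means boundedness in time of all Fourier modes, i.e. $\mathrm{Re}\,\nu(k_x,k_y)\le 0$ for all $(k_x,k_y)\in\mathbb{R}^2$. *)

theory Defs
  imports "HOL-Analysis.Analysis"
begin

type_synonym field = "real \<Rightarrow> real \<Rightarrow> complex"

text \<open>A field depends on \<open>x\<close> and \<open>y\<close>; a time-dependent field takes \<open>t\<close> as first argument.\<close>

definition partial_x :: "field \<Rightarrow> field" where
  "partial_x v = (\<lambda>x y. vector_derivative (\<lambda>s. v s y) (at x))"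

definition partial_y :: "field \<Rightarrow> field" where
  "partial_y v = (\<lambda>x y. vector_derivative (\<lambda>s. v x s) (at y))"

definition partial_t :: "(real \<Rightarrow> field) \<Rightarrow> real \<Rightarrow> field" where
  "partial_t u = (\<lambda>t x y. vector_derivative (\<lambda>s. u s x y) (at t))"

definition layer_Dx :: "real \<Rightarrow> real \<Rightarrow> field \<Rightarrow> field" where
  "layer_Dx \<beta> \<sigma> v = (\<lambda>x y. 1 / (1 + exp (\<i> * of_real pi / 4) * of_real \<sigma>) *
     (partial_x v x y
       - exp (\<i> * of_real pi / 4) * (of_real \<beta> / 2) * of_real \<sigma> * partial_y v x y))"

definition layer_Dy :: "real \<Rightarrow> real \<Rightarrow> field \<Rightarrow> field" where
  "layer_Dy \<beta> \<sigma> v = (\<lambda>x y. 1 / (1 + exp (\<i> * of_real pi / 4) * of_real \<sigma>) *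
     (partial_y v x y
       - exp (\<i> * of_real pi / 4) * (of_real \<beta> / 2) * of_real \<sigma> * partial_x v x y))"

definition corner_layer_lhs :: "real \<Rightarrow> real \<Rightarrow> (real \<Rightarrow> field) \<Rightarrow> real \<Rightarrow> field" where
  "corner_layer_lhs \<beta> \<sigma> u t = (\<lambda>x y. \<i> * partial_t u t x y
     + (layer_Dx \<beta> \<sigma> (layer_Dx \<beta> \<sigma> (u t)) x y
        + layer_Dy \<beta> \<sigma> (layer_Dy \<beta> \<sigma> (u t)) x y
        + of_real \<beta> * layer_Dx \<beta> \<sigma> (layer_Dy \<beta> \<sigma> (u t)) x y))"

definition fourier :: "field \<Rightarrow> real \<Rightarrow> real \<Rightarrow> complex" where
  "fourier v kx ky =
     (LINT p|lborel. exp (- \<i> * of_real (kx * fst p + ky * snd p)) * v (fst p) (snd p))"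

text \<open>
  The Fourier transform is applied to time-dependent fields that are once differentiable in \<open>t\<close>
  and twice in \<open>(x, y)\<close>, all these derivatives being continuous and, locally uniformly in \<open>t\<close>,
  bounded by an integrable weight. Continuously differentiable curves in the Schwartz space are
  included.
\<close>

definition decaying :: "(real \<Rightarrow> field) \<Rightarrow> bool" where
  "decaying w \<longleftrightarrow> continuous_on UNIV (\<lambda>(t, x, y). w t x y) \<and>
     (\<forall>T. \<exists>C. \<forall>t x y. \<bar>t\<bar> \<le> T \<longrightarrow> norm (w t x y) \<le> C / ((1 + x\<^sup>2) * (1 + y\<^sup>2)))"

definition partially_differentiable :: "field \<Rightarrow> bool" where
  "partially_differentiable v \<longleftrightarrow>
     (\<forall>x y. (\<lambda>s. v s y) differentiable (at x) \<and> (\<lambda>s. v x s) differentiable (at y))"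

definition decaying_fields :: "(real \<Rightarrow> field) set" where
  "decaying_fields = {u.
     (\<forall>t x y. (\<lambda>s. u s x y) differentiable (at t)) \<and>
     (\<forall>t. partially_differentiable (u t) \<and>
          partially_differentiable (partial_x (u t)) \<and>
          partially_differentiable (partial_y (u t))) \<and>
     decaying u \<and> decaying (partial_t u) \<and>
     decaying (\<lambda>t. partial_x (u t)) \<and> decaying (\<lambda>t. partial_y (u t)) \<and>
     decaying (\<lambda>t. partial_x (partial_x (u t))) \<and> decaying (\<lambda>t. partial_x (partial_y (u t))) \<and>
     decaying (\<lambda>t. partial_y (partial_x (u t))) \<and> decaying (\<lambda>t. partial_y (partial_y (u t)))}"

text \<open>
  The Fourier transform turns the equation into \<open>U' = \<nu> U\<close> for the transform \<open>U\<close> of \<open>u\<close>: at every time, the transform of the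
  left-hand side vanishes at \<open>(kx, ky)\<close> exactly when \<open>U\<close> satisfies this ordinary differential
  equation there. The field \<open>u\<close> is not required to be a solution.
\<close>

definition is_growth_rate :: "real \<Rightarrow> real \<Rightarrow> real \<Rightarrow> real \<Rightarrow> complex \<Rightarrow> bool" where
  "is_growth_rate \<beta> \<sigma> kx ky \<nu> \<longleftrightarrow>
     (\<forall>u \<in> decaying_fields. \<forall>t.
        fourier (corner_layer_lhs \<beta> \<sigma> u t) kx ky = 0 \<longleftrightarrow>
        ((\<lambda>s. fourier (u s) kx ky) has_vector_derivative \<nu> * fourier (u t) kx ky) (at t))"

definition growth_rate :: "real \<Rightarrow> real \<Rightarrow> real \<Rightarrow> real \<Rightarrow> complex" where
  "growth_rate \<beta> \<sigma> kx ky = (THE \<nu>. is_growth_rate \<beta> \<sigma> kx ky \<nu>)"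

definition corner_layer_stable :: "real \<Rightarrow> real \<Rightarrow> bool" where
  "corner_layer_stable \<beta> \<sigma> \<longleftrightarrow> (\<forall>kx ky. Re (growth_rate \<beta> \<sigma> kx ky) \<le> 0)"

text \<open>Only arguments in \<open>[0, 1)\<close> are meaningful.\<close>

definition sigma1 :: "real \<Rightarrow> ereal" where
  "sigma1 b = (if b = 0 then \<infinity>
     else ereal (sqrt 2 / (4 * b) * (2 - b + sqrt (b\<^sup>2 + 12 * b + 4))))"

end

theory Submission
  imports Defs "HOL-Probability.Sinc_Integral"
begin

text \<open>
  On the Fourier side each spatial derivative becomes multiplication by \<open>\<i> kx\<close> or \<open>\<i> ky\<close>, by
  integration by parts (\<open>fourier_partial_x\<close>, \<open>fourier_partial_y\<close>), and the time derivative passes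
  through the integral (\<open>fourier_partial_t\<close>). The equation therefore becomes
  \<open>\<i> U' + S(kx, ky) U = 0\<close> with a quadratic form \<open>S\<close> in the frequencies, and \<open>\<i> S\<close> is a growth rate.
  It is the only one, because there is an admissible field that evolves at this rate and has a
  nonzero Fourier coefficient at \<open>(kx, ky)\<close> (\<open>growth_rate_eq\<close>). This turns stability into the
  algebraic statement \<open>Im S \<ge> 0\<close>.

  With \<open>e = exp (\<i> \<pi> / 4)\<close> and \<open>g = e \<beta> \<sigma> / 2\<close>, passing to the frequencies \<open>kx + ky\<close> and \<open>kx - ky\<close>
  diagonalises the form (\<open>layer_symbol_diagonal\<close>): \<open>- S\<close> is a combination, with nonnegative
  coefficients since \<open>\<bar>\<beta>\<bar> < 1\<close>, of the two squares \<open>((1 - g) / (1 + e \<sigma>))\<^sup>2\<close> and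
  \<open>((1 + g) / (1 + e \<sigma>))\<^sup>2\<close>. It remains to see that both squares have nonpositive imaginary part. The
  numbers being squared have negative imaginary part, again because \<open>\<bar>\<beta>\<bar> < 1\<close>, so it suffices that
  their real parts are nonnegative (\<open>Im_diagonal_nonpos\<close>). In the worse of the two cases this is
  the quadratic inequality \<open>\<bar>\<beta>\<bar> \<sigma>\<^sup>2 / 2 - (1 - \<bar>\<beta>\<bar> / 2) \<sigma> / sqrt 2 \<le> 1\<close>, whose positive root is
  \<open>sigma1 \<bar>\<beta>\<bar>\<close> (\<open>sigma1_quadratic\<close>).
\<close>

section \<open>Dominated fields and their Fourier transform\<close>

text \<open>
  The time slices of a decaying field. This is the class on which the spatial Fourier integral
  converges absolutely and Fubini's theorem applies.
\<close>

definition dominated :: "field \<Rightarrow> bool" where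
  "dominated v \<longleftrightarrow> continuous_on UNIV (\<lambda>(x, y). v x y) \<and>
     (\<exists>C. \<forall>x y. norm (v x y) \<le> C / ((1 + x\<^sup>2) * (1 + y\<^sup>2)))"

lemma dominated_bound:
  assumes "dominated v"
  shows "\<exists>C. 0 \<le> C \<and> (\<forall>x y. norm (v x y) \<le> C / ((1 + x\<^sup>2) * (1 + y\<^sup>2)))"
proof -
  obtain C where C: "\<forall>x y. norm (v x y) \<le> C / ((1 + x\<^sup>2) * (1 + y\<^sup>2))"
    using conjunct2[OF iffD1[OF dominated_def assms]] ..
  have "0 \<le> C"
    using order_trans[OF norm_ge_zero C[rule_format, of 0 0]] by simp
  with C show ?thesis
    by (intro exI[of _ C] conjI)
qed

lemma dominatedI:
  assumes "continuous_on UNIV (\<lambda>p. v (fst p) (snd p))"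
    and "\<And>x y. norm (v x y) \<le> C / ((1 + x\<^sup>2) * (1 + y\<^sup>2))"
  shows "dominated v"
  unfolding dominated_def case_prod_unfold using assms(1)
  by (intro conjI exI[of _ C] allI assms(2))

lemma dominated_continuous:
  "dominated v \<Longrightarrow> continuous_on UNIV (\<lambda>p. v (fst p) (snd p))"
  unfolding dominated_def case_prod_unfold by (elim conjE)

lemma decaying_bound:
  assumes "decaying w"
  shows "\<exists>C. \<forall>t x y. \<bar>t\<bar> \<le> T \<longrightarrow> norm (w t x y) \<le> C / ((1 + x\<^sup>2) * (1 + y\<^sup>2))"
  by (rule spec[OF conjunct2[OF iffD1[OF decaying_def assms]]])

lemma decaying_imp_dominated:
  assumes "decaying w"
  shows "dominated (w t)"
proof -
  have c: "continuous_on UNIV (\<lambda>p. w (fst p) (fst (snd p)) (snd (snd p)))"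
    using assms unfolding decaying_def case_prod_unfold by (elim conjE)
  have "continuous_on UNIV (\<lambda>p::real \<times> real. (t, fst p, snd p))"
    by (intro continuous_intros)
  from continuous_on_compose2[OF c this]
  have "continuous_on UNIV (\<lambda>p. w t (fst p) (snd p))"
    by simp
  moreover obtain C
    where "\<forall>s x y. \<bar>s\<bar> \<le> \<bar>t\<bar> \<longrightarrow> norm (w s x y) \<le> C / ((1 + x\<^sup>2) * (1 + y\<^sup>2))"
    using decaying_bound[OF assms, of "\<bar>t\<bar>"] ..
  note this[rule_format, OF order_refl]
  ultimately show ?thesis
    by (rule dominatedI)
qed

lemma dominated_add:
  assumes "dominated v" "dominated w"
  shows "dominated (\<lambda>x y. v x y + w x y)"
proof -
  obtain C where "0 \<le> C \<and> (\<forall>x y. norm (v x y) \<le> C / ((1 + x\<^sup>2) * (1 + y\<^sup>2)))"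
    using dominated_bound[OF assms(1)] ..
  note C = this[THEN conjunct2, rule_format]
  obtain D where "0 \<le> D \<and> (\<forall>x y. norm (w x y) \<le> D / ((1 + x\<^sup>2) * (1 + y\<^sup>2)))"
    using dominated_bound[OF assms(2)] ..
  note D = this[THEN conjunct2, rule_format]
  have "norm (v x y + w x y) \<le> (C + D) / ((1 + x\<^sup>2) * (1 + y\<^sup>2))" for x y
    unfolding add_divide_distrib by (rule norm_triangle_mono[OF C D])
  then show ?thesis
    by (rule dominatedI[OF continuous_on_add[OF assms[THEN dominated_continuous]]])
qed

lemma dominated_cmult:
  assumes "dominated v"
  shows "dominated (\<lambda>x y. c * v x y)"
proof -
  obtain C where "0 \<le> C \<and> (\<forall>x y. norm (v x y) \<le> C / ((1 + x\<^sup>2) * (1 + y\<^sup>2)))"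
    using dominated_bound[OF assms(1)] ..
  note C = this[THEN conjunct2, rule_format]
  have "norm (c * v x y) \<le> (norm c * C) / ((1 + x\<^sup>2) * (1 + y\<^sup>2))" for x y
    using mult_left_mono[OF C[of x y], of "norm c"] by (simp add: norm_mult)
  then show ?thesis
    by (rule dominatedI[OF continuous_on_mult_left[OF dominated_continuous[OF assms]]])
qed

lemma dominated_swap:
  assumes "dominated v"
  shows "dominated (\<lambda>x y. v y x)"
proof -
  have "continuous_on UNIV (\<lambda>p::real \<times> real. (snd p, fst p))"
    by (intro continuous_intros)
  from continuous_on_compose2[OF dominated_continuous[OF assms] this]
  have "continuous_on UNIV (\<lambda>p. v (snd p) (fst p))"
    by simp
  moreover obtain C where "0 \<le> C \<and> (\<forall>x y. norm (v x y) \<le> C / ((1 + x\<^sup>2) * (1 + y\<^sup>2)))"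
    using dominated_bound[OF assms] ..
  note C = this[THEN conjunct2, rule_format]
  have "norm (v y x) \<le> C / ((1 + x\<^sup>2) * (1 + y\<^sup>2))" for x y
    using C[of y x] by (simp only: mult.commute)
  ultimately show ?thesis
    by (rule dominatedI)
qed

lemma integrable_decay1: "integrable lborel (\<lambda>x::real. C / (1 + x\<^sup>2))"
proof -
  have "integrable lborel (\<lambda>x::real. inverse (1 + x\<^sup>2))"
    using integrable_inverse_1_plus_square by (simp add: set_integrable_def)
  then have "integrable lborel (\<lambda>x::real. C * inverse (1 + x\<^sup>2))"
    by (rule integrable_mult_right)
  then show ?thesis by (simp add: divide_inverse)
qed

lemma integrable_decay2:
  "integrable lborel (\<lambda>p::real \<times> real. C / ((1 + (fst p)\<^sup>2) * (1 + (snd p)\<^sup>2)))"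
proof -
  have n: "norm (1 / ((1 + x\<^sup>2) * (1 + y\<^sup>2))) = 1 / (1 + x\<^sup>2) * (1 / (1 + y\<^sup>2))" for x y :: real
    by simp
  have "integrable (lborel \<Otimes>\<^sub>M lborel) (\<lambda>p::real \<times> real. 1 / ((1 + (fst p)\<^sup>2) * (1 + (snd p)\<^sup>2)))"
  proof (rule lborel_pair.Fubini_integrable)
    show "integrable lborel
        (\<lambda>x::real. LINT y|lborel. norm (1 / ((1 + (fst (x, y))\<^sup>2) * (1 + (snd (x, y::real))\<^sup>2))))"
      unfolding fst_conv snd_conv n
      by (simp del: times_divide_eq_left times_divide_eq_right add: integrable_decay1)
    have "integrable lborel (\<lambda>y::real. 1 / (1 + x\<^sup>2) * (1 / (1 + y\<^sup>2)))" for x :: real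
      by (intro integrable_mult_right integrable_decay1)
    then show "AE x in lborel. integrable lborel
        (\<lambda>y::real. 1 / ((1 + (fst (x::real, y))\<^sup>2) * (1 + (snd (x, y))\<^sup>2)))"
      by simp
  qed measurable
  then have "integrable lborel (\<lambda>p::real \<times> real. 1 / ((1 + (fst p)\<^sup>2) * (1 + (snd p)\<^sup>2)))"
    by (simp only: lborel_prod)
  from integrable_mult_right[OF this, of C] show ?thesis
    by simp
qed

lemma integrable_fourier:
  assumes "dominated v"
  shows "integrable lborel
    (\<lambda>p. exp (- \<i> * of_real (kx * fst p + ky * snd p)) * v (fst p) (snd p))"
proof -
  obtain C where "0 \<le> C \<and> (\<forall>x y. norm (v x y) \<le> C / ((1 + x\<^sup>2) * (1 + y\<^sup>2)))"
    using dominated_bound[OF assms] ..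
  note C = this[THEN conjunct2, rule_format]
  have "continuous_on UNIV (\<lambda>p. v (fst p) (snd p))"
    by (rule dominated_continuous[OF assms])
  then have "continuous_on UNIV
      (\<lambda>p. exp (- \<i> * of_real (kx * fst p + ky * snd p)) * v (fst p) (snd p))"
    by (intro continuous_intros)
  then have m: "(\<lambda>p. exp (- \<i> * of_real (kx * fst p + ky * snd p)) * v (fst p) (snd p))
      \<in> borel_measurable lborel"
    by (simp add: borel_measurable_continuous_onI)
  show ?thesis
  proof (rule Bochner_Integration.integrable_bound[OF integrable_decay2[of C] m], rule AE_I2)
    fix p :: "real \<times> real"
    have "norm (exp (- \<i> * of_real (kx * fst p + ky * snd p)) * v (fst p) (snd p))
        = norm (v (fst p) (snd p))"
      by (simp add: norm_mult norm_exp_eq_Re)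
    also have "\<dots> \<le> norm (C / ((1 + (fst p)\<^sup>2) * (1 + (snd p)\<^sup>2)))"
      using C[of "fst p" "snd p"] by (metis abs_ge_self order_trans real_norm_def)
    finally show "norm (exp (- \<i> * of_real (kx * fst p + ky * snd p)) * v (fst p) (snd p))
        \<le> norm (C / ((1 + (fst p)\<^sup>2) * (1 + (snd p)\<^sup>2)))" .
  qed
qed

lemma fourier_add:
  assumes "dominated v" "dominated w"
  shows "fourier (\<lambda>x y. v x y + w x y) kx ky = fourier v kx ky + fourier w kx ky"
  unfolding fourier_def distrib_left
  by (intro Bochner_Integration.integral_add integrable_fourier assms)

lemma fourier_cmult: "fourier (\<lambda>x y. c * v x y) kx ky = c * fourier v kx ky"
proof -
  have "fourier (\<lambda>x y. c * v x y) kx ky =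
      (LINT p|lborel. c * (exp (- \<i> * of_real (kx * fst p + ky * snd p)) * v (fst p) (snd p)))"
    unfolding fourier_def by (simp only: mult.left_commute)
  then show ?thesis
    unfolding fourier_def by simp
qed

lemma fourier_swap:
  assumes "dominated v"
  shows "fourier (\<lambda>x y. v y x) kx ky = fourier v ky kx"
proof -
  let ?f = "\<lambda>p. exp (- \<i> * of_real (ky * fst p + kx * snd p)) * v (fst p) (snd p)"
  have "?f \<in> borel_measurable (lborel \<Otimes>\<^sub>M lborel)"
    using borel_measurable_integrable[OF integrable_fourier[OF assms]] by (simp add: lborel_prod)
  from lborel_pair.integral_product_swap[OF this] show ?thesis
    unfolding fourier_def by (simp add: lborel_prod case_prod_unfold add.commute)
qed

section \<open>Differentiation in space\<close>

text \<open>
  Integration by parts on the whole line, obtained by integrating the derivative of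
  \<open>exp (- \<i> k x) * f x\<close>: both boundary terms vanish because \<open>f\<close> is bounded by a multiple of
  \<open>1 / (1 + x\<^sup>2)\<close>.
\<close>

lemma fourier_derivative_line:
  fixes f f' :: "real \<Rightarrow> complex"
  assumes deriv: "\<And>x. (f has_vector_derivative f' x) (at x)"
    and cont: "continuous_on UNIV f'"
    and f: "\<And>x. norm (f x) \<le> C / (1 + x\<^sup>2)" and f': "\<And>x. norm (f' x) \<le> C' / (1 + x\<^sup>2)"
  shows "(LINT x|lborel. exp (- \<i> * of_real (k * x)) * f' x)
    = \<i> * of_real k * (LINT x|lborel. exp (- \<i> * of_real (k * x)) * f x)"
proof -
  let ?E = "\<lambda>x. exp (- \<i> * of_real (k * x))"
  have contf: "continuous_on UNIV f"
    using deriv by (metis continuous_at_imp_continuous_on has_vector_derivative_continuous)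
  have int: "integrable lborel (\<lambda>x. ?E x * g x)"
    if g: "continuous_on UNIV g" and b: "\<And>x. norm (g x) \<le> D / (1 + x\<^sup>2)" for g :: "real \<Rightarrow> complex" and D
  proof (rule Bochner_Integration.integrable_bound[OF integrable_decay1[of D]])
    have "continuous_on UNIV (\<lambda>x. ?E x * g x)"
      by (intro continuous_intros g)
    then show "(\<lambda>x. ?E x * g x) \<in> borel_measurable lborel"
      by (simp add: borel_measurable_continuous_onI)
    show "AE x in lborel. norm (?E x * g x) \<le> norm (D / (1 + x\<^sup>2))"
      using order_trans[OF b abs_ge_self] by (simp add: norm_mult norm_exp_eq_Re)
  qed
  have intf: "integrable lborel (\<lambda>x. ?E x * f x)" and intf': "integrable lborel (\<lambda>x. ?E x * f' x)"
    using int[OF contf f] int[OF cont f'] by blast+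
  let ?g = "\<lambda>x. ?E x * f' x - \<i> * of_real k * (?E x * f x)"
  have lim: "((\<lambda>x. ?E x * f x) \<longlongrightarrow> 0) F" if "filterlim (\<lambda>x. 1 + x\<^sup>2) at_top F" for F :: "real filter"
  proof (rule Lim_null_comparison)
    show "\<forall>\<^sub>F x in F. norm (?E x * f x) \<le> C / (1 + x\<^sup>2)"
      using f by (simp add: norm_mult norm_exp_eq_Re)
    show "((\<lambda>x. C / (1 + x\<^sup>2)) \<longlongrightarrow> 0) F"
      by (rule real_tendsto_divide_at_top[OF tendsto_const that])
  qed
  have "(LBINT x=-\<infinity>..\<infinity>. ?g x) = 0 - 0"
  proof (rule interval_integral_FTC_integrable[where F="\<lambda>x. ?E x * f x"])
    fix x :: real
    have "((\<lambda>z. exp (- \<i> * (of_real k * z))) has_field_derivative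
        - (\<i> * of_real k) * exp (- \<i> * (of_real k * of_real x))) (at (of_real x))"
      by (auto intro!: derivative_eq_intros)
    from has_vector_derivative_real_field[OF this]
    have "(?E has_vector_derivative - (\<i> * of_real k) * ?E x) (at x)"
      by simp
    from has_vector_derivative_mult[OF this deriv[of x]]
    show "((\<lambda>x. ?E x * f x) has_vector_derivative ?g x) (at x)"
      by (simp add: algebra_simps)
    have "continuous_on UNIV ?g"
      by (intro continuous_intros cont contf)
    then show "isCont ?g x"
      by (simp add: continuous_on_eq_continuous_at)
  next
    show "set_integrable lborel (einterval (-\<infinity>) \<infinity>) ?g"
      using intf intf' by (simp add: set_integrable_def)
    have "filterlim (\<lambda>x::real. 1 + x\<^sup>2) at_top at_bot" "filterlim (\<lambda>x::real. 1 + x\<^sup>2) at_top at_top"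
      by (intro filterlim_tendsto_add_at_top[OF tendsto_const] filterlim_pow_at_bot_even
          filterlim_pow_at_top filterlim_ident; simp)+
    then show "(((\<lambda>x. ?E x * f x) \<circ> real_of_ereal) \<longlongrightarrow> 0) (at_right (-\<infinity>))"
      "(((\<lambda>x. ?E x * f x) \<circ> real_of_ereal) \<longlongrightarrow> 0) (at_left \<infinity>)"
      by (simp_all only: ereal_tendsto_simps1 ereal_tendsto_simps2 lim)
  qed simp
  then have "(LINT x|lborel. ?g x) = 0"
    by (simp add: interval_lebesgue_integral_def set_lebesgue_integral_def)
  moreover have "(LINT x|lborel. ?g x)
      = (LINT x|lborel. ?E x * f' x) - \<i> * of_real k * (LINT x|lborel. ?E x * f x)"
    using intf intf' by (subst Bochner_Integration.integral_diff) auto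
  ultimately show ?thesis by simp
qed

text \<open>
  The order of integration leaves \<open>x\<close> innermost, as integration by parts in \<open>x\<close> requires.
\<close>

lemma fourier_iterated:
  assumes "dominated v"
  shows "fourier v kx ky = (LINT y|lborel. exp (- \<i> * of_real (ky * y)) *
    (LINT x|lborel. exp (- \<i> * of_real (kx * x)) * v x y))"
proof -
  have s: "exp (- \<i> * of_real (kx * x + ky * y)) * v x y
      = exp (- \<i> * of_real (ky * y)) * (exp (- \<i> * of_real (kx * x)) * v x y)" for x y
    by (simp add: exp_add[symmetric] algebra_simps)
  have "integrable (lborel \<Otimes>\<^sub>M lborel)
      (\<lambda>(x, y). exp (- \<i> * of_real (kx * x + ky * y)) * v x y)"
    using integrable_fourier[OF assms] by (simp only: lborel_prod case_prod_unfold)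
  from lborel_pair.integral_snd[OF this] show ?thesis
    unfolding fourier_def s by (simp add: lborel_prod case_prod_unfold)
qed

lemma has_vector_derivative_partial_x:
  "partially_differentiable v \<Longrightarrow> ((\<lambda>s. v s y) has_vector_derivative partial_x v x y) (at x)"
  unfolding partially_differentiable_def partial_x_def by (simp add: vector_derivative_works[symmetric])

lemma has_vector_derivative_partial_y:
  "partially_differentiable v \<Longrightarrow> ((\<lambda>s. v x s) has_vector_derivative partial_y v x y) (at y)"
  unfolding partially_differentiable_def partial_y_def by (simp add: vector_derivative_works[symmetric])

lemma fourier_partial_x:
  assumes v: "dominated v" "partially_differentiable v" and v': "dominated (partial_x v)"
  shows "fourier (partial_x v) kx ky = \<i> * of_real kx * fourier v kx ky"
proof -
  obtain C where "0 \<le> C \<and> (\<forall>x y. norm (v x y) \<le> C / ((1 + x\<^sup>2) * (1 + y\<^sup>2)))"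
    using dominated_bound[OF v(1)] ..
  note C = this[THEN conjunct1] this[THEN conjunct2, rule_format]
  obtain D where "0 \<le> D \<and> (\<forall>x y. norm (partial_x v x y) \<le> D / ((1 + x\<^sup>2) * (1 + y\<^sup>2)))"
    using dominated_bound[OF v'] ..
  note D = this[THEN conjunct1] this[THEN conjunct2, rule_format]
  have le: "A / ((1 + x\<^sup>2) * (1 + y\<^sup>2)) \<le> A / (1 + x\<^sup>2)" if "0 \<le> A" for A x y :: real
  proof -
    have "(1 + x\<^sup>2) * 1 \<le> (1 + x\<^sup>2) * (1 + y\<^sup>2)"
      by (intro mult_left_mono) auto
    then have "1 + x\<^sup>2 \<le> (1 + x\<^sup>2) * (1 + y\<^sup>2)" by simp
    then show ?thesis
      using that by (intro divide_left_mono) (auto intro!: mult_pos_pos add_pos_nonneg)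
  qed
  have line: "(LINT x|lborel. exp (- \<i> * of_real (kx * x)) * partial_x v x y)
      = \<i> * of_real kx * (LINT x|lborel. exp (- \<i> * of_real (kx * x)) * v x y)" for y
  proof (rule fourier_derivative_line)
    show "((\<lambda>x. v x y) has_vector_derivative partial_x v x y) (at x)" for x
      by (rule has_vector_derivative_partial_x[OF v(2)])
    have "continuous_on UNIV (\<lambda>x::real. (x, y))"
      by (intro continuous_intros)
    from continuous_on_compose2[OF dominated_continuous[OF v'] this]
    show "continuous_on UNIV (\<lambda>x. partial_x v x y)" by simp
    show "norm (v x y) \<le> C / (1 + x\<^sup>2)" for x
      by (rule order_trans[OF C(2) le[OF C(1)]])
    show "norm (partial_x v x y) \<le> D / (1 + x\<^sup>2)" for x
      by (rule order_trans[OF D(2) le[OF D(1)]])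
  qed
  have factor: "exp z * (\<i> * of_real kx * I) = \<i> * of_real kx * (exp z * I)" for z I :: complex
    by (rule mult.left_commute)
  show ?thesis
    unfolding fourier_iterated[OF v(1)] fourier_iterated[OF v'] line factor
    by (rule integral_mult_right_zero)
qed

text \<open>
  Exchanging the coordinates reduces this rule to the one for \<open>x\<close>.
\<close>

lemma fourier_partial_y:
  assumes v: "dominated v" "partially_differentiable v" and v': "dominated (partial_y v)"
  shows "fourier (partial_y v) kx ky = \<i> * of_real ky * fourier v kx ky"
proof -
  let ?w = "\<lambda>x y. v y x"
  have w': "partial_x ?w = (\<lambda>x y. partial_y v y x)"
    by (simp add: partial_x_def partial_y_def)
  have "partially_differentiable ?w"
    using v(2) by (simp add: partially_differentiable_def)
  moreover have "dominated (partial_x ?w)"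
    unfolding w' by (rule dominated_swap[OF v'])
  ultimately have "fourier (partial_x ?w) ky kx = \<i> * of_real ky * fourier ?w ky kx"
    by (rule fourier_partial_x[OF dominated_swap[OF v(1)]])
  then show ?thesis
    by (simp add: w' fourier_swap[OF v(1)] fourier_swap[OF v'])
qed

section \<open>Differentiation in time\<close>

text \<open>
  Dominated convergence along sequences \<open>s\<^sub>n \<longrightarrow> t\<close>, applied to the remainders of the first-order
  expansion at \<open>t\<close>. By the mean value inequality each remainder, divided by \<open>\<bar>s\<^sub>n - t\<bar>\<close>, is at most twice
  the bound on the time derivative, and that bound is integrable in \<open>(x, y)\<close> and uniform for \<open>s\<^sub>n\<close> in a
  bounded interval.
\<close>

lemma fourier_partial_t:
  assumes diff: "\<And>t x y. (\<lambda>s. u s x y) differentiable (at t)"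
    and u: "decaying u" and ut: "decaying (partial_t u)"
  shows "((\<lambda>s. fourier (u s) kx ky) has_vector_derivative fourier (partial_t u t) kx ky) (at t)"
proof -
  have deriv: "((\<lambda>s. u s x y) has_vector_derivative partial_t u t x y) (at t)" for t x y
    using diff by (simp add: vector_derivative_works[symmetric] partial_t_def)
  let ?K = "\<lambda>p. exp (- \<i> * of_real (kx * fst p + ky * snd p))"
  let ?q = "\<lambda>s p. (u s (fst p) (snd p) - u t (fst p) (snd p)
    - (s - t) *\<^sub>R partial_t u t (fst p) (snd p)) /\<^sub>R norm (s - t)"
  have int_u: "integrable lborel (\<lambda>p. ?K p * u s (fst p) (snd p))" for s
    by (rule integrable_fourier[OF decaying_imp_dominated[OF u]])
  have int_ut: "integrable lborel (\<lambda>p. ?K p * partial_t u t (fst p) (snd p))"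
    by (rule integrable_fourier[OF decaying_imp_dominated[OF ut]])
  have q_eq: "?K p * ?q s p = (?K p * u s (fst p) (snd p) - ?K p * u t (fst p) (snd p)
    - (s - t) *\<^sub>R (?K p * partial_t u t (fst p) (snd p))) /\<^sub>R norm (s - t)" for s p
    by (simp add: right_diff_distrib)
  have int_q: "integrable lborel (\<lambda>p. ?K p * ?q s p)" for s
    unfolding q_eq by (intro integrable_scaleR_right Bochner_Integration.integrable_diff int_u int_ut)
  have lint_q: "(LINT p|lborel. ?K p * ?q s p) = (fourier (u s) kx ky - fourier (u t) kx ky
      - (s - t) *\<^sub>R fourier (partial_t u t) kx ky) /\<^sub>R norm (s - t)" for s
    unfolding fourier_def q_eq using int_u int_ut
    by (simp only: integral_scaleR_right Bochner_Integration.integral_diff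
        Bochner_Integration.integrable_diff integrable_scaleR_right)
  have "((\<lambda>s. LINT p|lborel. ?K p * ?q s p) \<longlongrightarrow> 0) (at t)"
    unfolding tendsto_at_iff_sequentially
  proof (intro allI impI)
    fix X :: "nat \<Rightarrow> real"
    assume X: "\<forall>i. X i \<in> UNIV - {t}" "X \<longlonglongrightarrow> t"
    obtain B where B: "\<And>n. \<bar>X n\<bar> \<le> B"
      using convergent_imp_Bseq[OF convergentI[OF X(2)]] unfolding Bseq_def by auto
    \<comment> \<open>One time interval contains the whole sequence and its limit, so one bound serves all \<open>n\<close>.\<close>
    define T where "T = max B \<bar>t\<bar>"
    obtain C where
      "\<forall>s x y. \<bar>s\<bar> \<le> T \<longrightarrow> norm (partial_t u s x y) \<le> C / ((1 + x\<^sup>2) * (1 + y\<^sup>2))"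
      using decaying_bound[OF ut, of T] ..
    note C = this[rule_format]
    have "(\<lambda>n. LINT p|lborel. ?K p * ?q (X n) p) \<longlonglongrightarrow> (LINT p::real\<times>real|lborel. 0)"
    proof (rule integral_dominated_convergence)
      show "integrable lborel (\<lambda>p::real\<times>real. (2 * C) / ((1 + (fst p)\<^sup>2) * (1 + (snd p)\<^sup>2)))"
        by (rule integrable_decay2)
      show "(\<lambda>p. ?K p * ?q (X n) p) \<in> borel_measurable lborel" for n
        by (rule borel_measurable_integrable[OF int_q])
      show "AE p in lborel. (\<lambda>n. ?K p * ?q (X n) p) \<longlonglongrightarrow> 0"
      proof (rule AE_I2)
        fix p
        have "((\<lambda>s. ?q s p) \<longlongrightarrow> 0) (at t)"
          using deriv[where t=t and x="fst p" and y="snd p"]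
          by (simp add: has_vector_derivative_def has_derivative_at_within)
        then have "((\<lambda>s. ?q s p) \<circ> X) \<longlonglongrightarrow> 0"
          using X unfolding tendsto_at_iff_sequentially by blast
        then have "(\<lambda>n. ?q (X n) p) \<longlonglongrightarrow> 0"
          by (simp add: o_def)
        from tendsto_mult_left[OF this, of "?K p"] show "(\<lambda>n. ?K p * ?q (X n) p) \<longlonglongrightarrow> 0"
          by simp
      qed
      show "AE p in lborel. norm (?K p * ?q (X n) p)
          \<le> (2 * C) / ((1 + (fst p)\<^sup>2) * (1 + (snd p)\<^sup>2))" for n
      proof (rule AE_I2)
        fix p :: "real \<times> real"
        let ?D = "C / ((1 + (fst p)\<^sup>2) * (1 + (snd p)\<^sup>2))"
        have "norm (u (X n) (fst p) (snd p) - u t (fst p) (snd p)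
            - (X n - t) *\<^sub>R partial_t u t (fst p) (snd p)) \<le> norm (X n - t) * (2 * ?D)"
        proof (rule vector_differentiable_bound_linearization[where S="{-T..T}"
              and f="\<lambda>s. u s (fst p) (snd p)" and f'="\<lambda>s. partial_t u s (fst p) (snd p)" and ?x0.0=t])
          show "((\<lambda>s. u s (fst p) (snd p)) has_vector_derivative partial_t u s (fst p) (snd p))
              (at s within {-T..T})" for s
            by (rule has_vector_derivative_at_within[OF deriv])
          have "\<bar>X n\<bar> \<le> T" "\<bar>t\<bar> \<le> T"
            using B[of n] by (auto simp: T_def)
          then show "closed_segment t (X n) \<subseteq> {-T..T}" and t: "t \<in> {-T..T}"
            by (auto simp: closed_segment_eq_real_ivl)
          show "norm (partial_t u s (fst p) (snd p) - partial_t u t (fst p) (snd p)) \<le> 2 * ?D"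
            if "s \<in> {-T..T}" for s
            using norm_triangle_le_diff[OF add_mono[OF C[of s "fst p" "snd p"] C[of t "fst p" "snd p"]]]
              that t by (simp add: abs_le_iff)
        qed
        moreover have pos: "0 < norm (X n - t)"
          using X(1) by simp
        ultimately have "norm (u (X n) (fst p) (snd p) - u t (fst p) (snd p)
            - (X n - t) *\<^sub>R partial_t u t (fst p) (snd p)) / norm (X n - t) \<le> 2 * ?D"
          by (simp only: pos_divide_le_eq mult.commute)
        then have "norm (?q (X n) p) \<le> 2 * ?D"
          by (simp add: divide_inverse mult.commute)
        then show "norm (?K p * ?q (X n) p) \<le> (2 * C) / ((1 + (fst p)\<^sup>2) * (1 + (snd p)\<^sup>2))"
          by (simp add: norm_mult norm_exp_eq_Re)
      qed
    qed simp
    then show "((\<lambda>s. LINT p|lborel. ?K p * ?q s p) \<circ> X) \<longlonglongrightarrow> 0"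
      by (simp add: o_def)
  qed
  then show ?thesis
    unfolding lint_q has_vector_derivative_def has_derivative_at_within
    by (simp add: bounded_linear_scaleR_left)
qed

section \<open>The symbol of the corner layer equation\<close>

text \<open>
  The requirements under which both first derivatives become multiplications on the Fourier side. For
  a field in \<open>decaying_fields\<close> they hold at every time for the slice and for its two first
  derivatives, hence for its images under the first-order operators of the layer, which can
  therefore be applied a second time.
\<close>

definition regular :: "field \<Rightarrow> bool" where
  "regular v \<longleftrightarrow> partially_differentiable v \<and> dominated v \<and>
     dominated (partial_x v) \<and> dominated (partial_y v)"

definition layer_coeff :: "real \<Rightarrow> complex" where
  "layer_coeff \<sigma> = 1 / (1 + exp (\<i> * of_real pi / 4) * of_real \<sigma>)"

definition layer_skew :: "real \<Rightarrow> real \<Rightarrow> complex" where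
  "layer_skew \<beta> \<sigma> = exp (\<i> * of_real pi / 4) * (of_real \<beta> / 2) * of_real \<sigma>"

text \<open>
  The factor that \<open>D\<^sub>x\<^sup>2 + D\<^sub>y\<^sup>2 + \<beta> D\<^sub>x D\<^sub>y\<close> becomes when \<open>\<partial>\<^sub>x\<close> and \<open>\<partial>\<^sub>y\<close> are replaced by
  \<open>\<i> kx\<close> and \<open>\<i> ky\<close>.
\<close>

definition layer_symbol :: "real \<Rightarrow> real \<Rightarrow> real \<Rightarrow> real \<Rightarrow> complex" where
  "layer_symbol \<beta> \<sigma> kx ky =
    (let X = layer_coeff \<sigma> * (\<i> * of_real kx - layer_skew \<beta> \<sigma> * (\<i> * of_real ky));
         Y = layer_coeff \<sigma> * (\<i> * of_real ky - layer_skew \<beta> \<sigma> * (\<i> * of_real kx))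
     in X\<^sup>2 + Y\<^sup>2 + of_real \<beta> * X * Y)"

lemma layer_Dx_eq:
  "layer_Dx \<beta> \<sigma> v = (\<lambda>x y. layer_coeff \<sigma> * (partial_x v x y + - layer_skew \<beta> \<sigma> * partial_y v x y))"
  by (simp add: layer_Dx_def layer_coeff_def layer_skew_def)

lemma layer_Dy_eq:
  "layer_Dy \<beta> \<sigma> v = (\<lambda>x y. layer_coeff \<sigma> * (partial_y v x y + - layer_skew \<beta> \<sigma> * partial_x v x y))"
  by (simp add: layer_Dy_def layer_coeff_def layer_skew_def)

lemma dominated_lincomb:
  assumes "dominated v" "dominated w"
  shows "dominated (\<lambda>x y. a * (v x y + b * w x y))"
  by (rule dominated_cmult[OF dominated_add[OF assms(1) dominated_cmult[OF assms(2)]]])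

lemma fourier_lincomb:
  assumes "dominated v" "dominated w"
  shows "fourier (\<lambda>x y. a * (v x y + b * w x y)) kx ky
    = a * (fourier v kx ky + b * fourier w kx ky)"
  using assms by (simp add: fourier_cmult fourier_add dominated_cmult)

lemma regular_lincomb:
  assumes "regular v" "regular w"
  shows "regular (\<lambda>x y. a * (v x y + b * w x y))"
proof -
  let ?z = "\<lambda>x y. a * (v x y + b * w x y)"
  have x: "((\<lambda>s. ?z s y) has_vector_derivative a * (partial_x v x y + b * partial_x w x y)) (at x)"
    and y: "((\<lambda>s. ?z x s) has_vector_derivative a * (partial_y v x y + b * partial_y w x y)) (at y)" for x y
    using assms unfolding regular_def
    by (intro has_vector_derivative_mult_right has_vector_derivative_add
        has_vector_derivative_partial_x has_vector_derivative_partial_y; simp)+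
  have "partial_x ?z = (\<lambda>x y. a * (partial_x v x y + b * partial_x w x y))"
    "partial_y ?z = (\<lambda>x y. a * (partial_y v x y + b * partial_y w x y))"
    unfolding partial_x_def[of ?z] partial_y_def[of ?z]
    by (intro ext vector_derivative_at x y)+
  moreover have "partially_differentiable ?z"
    unfolding partially_differentiable_def using x y differentiableI_vector by blast
  ultimately show ?thesis
    using assms unfolding regular_def by (auto intro!: dominated_lincomb)
qed

lemma fourier_layer_D:
  assumes "regular v"
  shows "fourier (layer_Dx \<beta> \<sigma> v) kx ky
      = layer_coeff \<sigma> * (\<i> * of_real kx - layer_skew \<beta> \<sigma> * (\<i> * of_real ky)) * fourier v kx ky"
    and "fourier (layer_Dy \<beta> \<sigma> v) kx ky
      = layer_coeff \<sigma> * (\<i> * of_real ky - layer_skew \<beta> \<sigma> * (\<i> * of_real kx)) * fourier v kx ky"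
    and "dominated (layer_Dx \<beta> \<sigma> v)" and "dominated (layer_Dy \<beta> \<sigma> v)"
proof -
  have v: "partially_differentiable v" "dominated v" "dominated (partial_x v)" "dominated (partial_y v)"
    using assms by (auto simp: regular_def)
  show "fourier (layer_Dx \<beta> \<sigma> v) kx ky
      = layer_coeff \<sigma> * (\<i> * of_real kx - layer_skew \<beta> \<sigma> * (\<i> * of_real ky)) * fourier v kx ky"
    "fourier (layer_Dy \<beta> \<sigma> v) kx ky
      = layer_coeff \<sigma> * (\<i> * of_real ky - layer_skew \<beta> \<sigma> * (\<i> * of_real kx)) * fourier v kx ky"
    unfolding layer_Dx_eq layer_Dy_eq fourier_lincomb[OF v(3,4)] fourier_lincomb[OF v(4,3)]
      fourier_partial_x[OF v(2,1,3)] fourier_partial_y[OF v(2,1,4)]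
    by (simp_all add: algebra_simps)
  show "dominated (layer_Dx \<beta> \<sigma> v)" "dominated (layer_Dy \<beta> \<sigma> v)"
    unfolding layer_Dx_eq layer_Dy_eq by (rule dominated_lincomb[OF v(3,4)] dominated_lincomb[OF v(4,3)])+
qed

lemma fourier_corner_layer_lhs:
  assumes "u \<in> decaying_fields"
  shows "fourier (corner_layer_lhs \<beta> \<sigma> u t) kx ky
    = \<i> * fourier (partial_t u t) kx ky + layer_symbol \<beta> \<sigma> kx ky * fourier (u t) kx ky"
proof -
  have "decaying u" "decaying (partial_t u)"
    "decaying (\<lambda>t. partial_x (u t))" "decaying (\<lambda>t. partial_y (u t))"
    "decaying (\<lambda>t. partial_x (partial_x (u t)))" "decaying (\<lambda>t. partial_x (partial_y (u t)))"
    "decaying (\<lambda>t. partial_y (partial_x (u t)))" "decaying (\<lambda>t. partial_y (partial_y (u t)))"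
    using assms by (auto simp: decaying_fields_def)
  note dom = this[THEN decaying_imp_dominated, of t]
  have reg: "regular (u t)" "regular (partial_x (u t))" "regular (partial_y (u t))"
    using dom assms by (simp_all add: regular_def decaying_fields_def)
  have regD: "regular (layer_Dx \<beta> \<sigma> (u t))" "regular (layer_Dy \<beta> \<sigma> (u t))"
    unfolding layer_Dx_eq layer_Dy_eq by (intro regular_lincomb reg)+
  note D = fourier_layer_D[where \<beta>=\<beta> and \<sigma>=\<sigma>]
  show ?thesis
    unfolding corner_layer_lhs_def layer_symbol_def Let_def
    by (simp add: fourier_add fourier_cmult dominated_add dominated_cmult dom(2)
        D[OF regD(1)] D[OF regD(2)] D[OF reg(1)] distrib_right power2_eq_square mult.assoc)
qed

text \<open>
  Writing \<open>U\<close> for the transform and \<open>S\<close> for the symbol, the transformed left-hand side is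
  \<open>\<i> U' + S U = \<i> (U' - \<i> S U)\<close>, and \<open>U'\<close> is the actual time derivative of \<open>U\<close>.
\<close>

lemma is_growth_rate_symbol: "is_growth_rate \<beta> \<sigma> kx ky (\<i> * layer_symbol \<beta> \<sigma> kx ky)"
  unfolding is_growth_rate_def
proof (intro ballI allI)
  fix u t
  assume u: "u \<in> decaying_fields"
  let ?U = "fourier (u t) kx ky" and ?U' = "fourier (partial_t u t) kx ky"
    and ?S = "layer_symbol \<beta> \<sigma> kx ky"
  have d: "((\<lambda>s. fourier (u s) kx ky) has_vector_derivative ?U') (at t)"
    using u by (intro fourier_partial_t) (auto simp: decaying_fields_def)
  have "\<i> * ?U' + ?S * ?U = \<i> * (?U' - \<i> * ?S * ?U)"
    by (simp add: algebra_simps)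
  then have "fourier (corner_layer_lhs \<beta> \<sigma> u t) kx ky = 0 \<longleftrightarrow> ?U' = \<i> * ?S * ?U"
    unfolding fourier_corner_layer_lhs[OF u] by simp
  also have "\<dots> \<longleftrightarrow> ((\<lambda>s. fourier (u s) kx ky) has_vector_derivative \<i> * ?S * ?U) (at t)"
    using d vector_derivative_unique_at by metis
  finally show "fourier (corner_layer_lhs \<beta> \<sigma> u t) kx ky = 0 \<longleftrightarrow>
      ((\<lambda>s. fourier (u s) kx ky) has_vector_derivative \<i> * ?S * ?U) (at t)" .
qed

section \<open>Uniqueness of the growth rate\<close>

text \<open>
  Fields with exponential time dependence and separated variables. A single one of them with a
  nonzero Fourier coefficient at \<open>(kx, ky)\<close>, evolving at the rate given by the symbol, excludes any
  other growth rate.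
\<close>

definition separated_mode :: "complex \<Rightarrow> (real \<Rightarrow> complex) \<Rightarrow> (real \<Rightarrow> complex) \<Rightarrow> real \<Rightarrow> field" where
  "separated_mode \<nu> a b = (\<lambda>t x y. exp (\<nu> * of_real t) * a x * b y)"

definition decaying_line :: "(real \<Rightarrow> complex) \<Rightarrow> bool" where
  "decaying_line a \<longleftrightarrow> continuous_on UNIV a \<and> (\<exists>C. \<forall>x. norm (a x) \<le> C / (1 + x\<^sup>2))"

lemma decaying_lineI:
  assumes "continuous_on UNIV a" "\<And>x. norm (a x) \<le> C / (1 + x\<^sup>2)"
  shows "decaying_line a"
  unfolding decaying_line_def using assms by (intro conjI exI[of _ C] allI)

lemma decaying_line_bound: "decaying_line a \<Longrightarrow> \<exists>C. \<forall>x. norm (a x) \<le> C / (1 + x\<^sup>2)"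
  unfolding decaying_line_def by (rule conjunct2)

lemma decaying_separated_mode:
  assumes "decaying_line a" "decaying_line b"
  shows "decaying (separated_mode \<nu> a b)"
proof -
  obtain A where A: "\<forall>x. norm (a x) \<le> A / (1 + x\<^sup>2)"
    using decaying_line_bound[OF assms(1)] ..
  obtain B where B: "\<forall>x. norm (b x) \<le> B / (1 + x\<^sup>2)"
    using decaying_line_bound[OF assms(2)] ..
  have nonneg: "0 \<le> B / (1 + x\<^sup>2)" "0 \<le> A / (1 + x\<^sup>2)" for x
    by (rule order_trans[OF norm_ge_zero B[rule_format]], rule order_trans[OF norm_ge_zero A[rule_format]])
  have ca: "continuous_on UNIV (\<lambda>p::real\<times>real\<times>real. a (fst (snd p)))"
    using assms(1) by (auto simp: decaying_line_def intro!: continuous_on_compose2[of UNIV a] continuous_intros)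
  have cb: "continuous_on UNIV (\<lambda>p::real\<times>real\<times>real. b (snd (snd p)))"
    using assms(2) by (auto simp: decaying_line_def intro!: continuous_on_compose2[of UNIV b] continuous_intros)
  have "continuous_on UNIV (\<lambda>(t, x, y). separated_mode \<nu> a b t x y)"
    unfolding separated_mode_def case_prod_unfold by (intro continuous_intros ca cb)
  moreover have "norm (separated_mode \<nu> a b t x y)
      \<le> exp (norm \<nu> * T) * A * B / ((1 + x\<^sup>2) * (1 + y\<^sup>2))" if "\<bar>t\<bar> \<le> T" for t x y T
  proof -
    have "norm (exp (\<nu> * of_real t)) \<le> exp (norm (\<nu> * of_real t))"
      by (rule norm_exp)
    also have "\<dots> \<le> exp (norm \<nu> * T)"
      using that by (simp add: norm_mult mult_left_mono)
    finally have "norm (exp (\<nu> * of_real t) * a x * b y)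
        \<le> exp (norm \<nu> * T) * (A / (1 + x\<^sup>2)) * (B / (1 + y\<^sup>2))"
      unfolding norm_mult by (intro mult_mono A[rule_format] B[rule_format] mult_nonneg_nonneg nonneg) auto
    then show ?thesis
      by (simp add: separated_mode_def)
  qed
  ultimately show ?thesis
    unfolding decaying_def by (intro conjI allI exI impI)
qed

lemma partial_separated_mode:
  assumes "\<And>x. (a has_vector_derivative a' x) (at x)" "\<And>y. (b has_vector_derivative b' y) (at y)"
  shows "partial_x (separated_mode \<nu> a b t) = separated_mode \<nu> a' b t"
    and "partial_y (separated_mode \<nu> a b t) = separated_mode \<nu> a b' t"
    and "partially_differentiable (separated_mode \<nu> a b t)"
proof -
  have x: "((\<lambda>s. separated_mode \<nu> a b t s y) has_vector_derivative separated_mode \<nu> a' b t x y) (at x)" for x y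
    unfolding separated_mode_def
    by (rule has_vector_derivative_mult_left[OF has_vector_derivative_mult_right[OF assms(1)]])
  have y: "((\<lambda>s. separated_mode \<nu> a b t x s) has_vector_derivative separated_mode \<nu> a b' t x y) (at y)" for x y
    unfolding separated_mode_def by (rule has_vector_derivative_mult_right[OF assms(2)])
  show "partial_x (separated_mode \<nu> a b t) = separated_mode \<nu> a' b t"
    "partial_y (separated_mode \<nu> a b t) = separated_mode \<nu> a b' t"
    unfolding partial_x_def partial_y_def by (intro ext vector_derivative_at x y)+
  show "partially_differentiable (separated_mode \<nu> a b t)"
    unfolding partially_differentiable_def using x y differentiableI_vector by blast
qed

lemma has_vector_derivative_separated_mode_t:
  "((\<lambda>s. separated_mode \<nu> a b s x y) has_vector_derivative \<nu> * separated_mode \<nu> a b t x y) (at t)"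
proof -
  have "((\<lambda>z. exp (\<nu> * z)) has_field_derivative \<nu> * exp (\<nu> * of_real t)) (at (of_real t))"
    by (auto intro!: derivative_eq_intros)
  from has_vector_derivative_real_field[OF this]
  have "((\<lambda>s. exp (\<nu> * of_real s)) has_vector_derivative \<nu> * exp (\<nu> * of_real t)) (at t)" .
  from has_vector_derivative_mult_left[OF has_vector_derivative_mult_left[OF this, of "a x"], of "b y"]
  show ?thesis
    by (simp add: separated_mode_def mult.assoc)
qed

lemma decaying_fields_separated_mode:
  assumes a: "\<And>x. (a has_vector_derivative a' x) (at x)" "\<And>x. (a' has_vector_derivative a'' x) (at x)"
    and da: "decaying_line a" "decaying_line a'" "decaying_line a''"
    and b: "\<And>y. (b has_vector_derivative b' y) (at y)" "\<And>y. (b' has_vector_derivative b'' y) (at y)"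
    and db: "decaying_line b" "decaying_line b'" "decaying_line b''"
  shows "separated_mode \<nu> a b \<in> decaying_fields"
proof -
  have t: "partial_t (separated_mode \<nu> a b) = separated_mode \<nu> (\<lambda>x. \<nu> * a x) b"
    unfolding partial_t_def
    by (intro ext) (simp add: vector_derivative_at[OF has_vector_derivative_separated_mode_t],
        simp add: separated_mode_def)
  obtain C where C: "\<forall>x. norm (a x) \<le> C / (1 + x\<^sup>2)"
    using decaying_line_bound[OF da(1)] ..
  have "norm (\<nu> * a x) \<le> (norm \<nu> * C) / (1 + x\<^sup>2)" for x
    using mult_left_mono[OF C[rule_format, of x], of "norm \<nu>"] by (simp add: norm_mult)
  moreover have "continuous_on UNIV (\<lambda>x. \<nu> * a x)"
    using da(1) unfolding decaying_line_def by (intro continuous_intros) auto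
  ultimately have "decaying_line (\<lambda>x. \<nu> * a x)"
    by (rule decaying_lineI[rotated])
  moreover have "(\<lambda>s. separated_mode \<nu> a b s x y) differentiable (at t)" for x y t
    by (rule differentiableI_vector[OF has_vector_derivative_separated_mode_t])
  ultimately show ?thesis
    unfolding decaying_fields_def
    by (simp add: partial_separated_mode[OF a(1) b(1)] partial_separated_mode[OF a(2) b(1)]
        partial_separated_mode[OF a(1) b(2)] da db decaying_separated_mode t)
qed

lemma decaying_line_product:
  fixes r :: "real \<Rightarrow> real"
  assumes "continuous_on UNIV r" "\<And>x. \<bar>r x\<bar> \<le> C / (1 + x\<^sup>2)"
  shows "decaying_line (\<lambda>x. c * exp (\<i> * of_real (k * x)) * of_real (r x))"
proof -
  have "norm (c * exp (\<i> * of_real (k * x)) * of_real (r x)) \<le> (norm c * C) / (1 + x\<^sup>2)" for x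
    using mult_left_mono[OF assms(2)[of x], of "norm c"] by (simp add: norm_mult norm_exp_eq_Re)
  moreover have "continuous_on UNIV (\<lambda>x. c * exp (\<i> * of_real (k * x)) * of_real (r x))"
    by (intro continuous_intros assms(1))
  ultimately show ?thesis
    by (rule decaying_lineI[rotated])
qed

lemma decaying_line_add:
  assumes "decaying_line a" "decaying_line b"
  shows "decaying_line (\<lambda>x. a x + b x)"
proof -
  obtain A where A: "\<forall>x. norm (a x) \<le> A / (1 + x\<^sup>2)"
    using decaying_line_bound[OF assms(1)] ..
  obtain B where B: "\<forall>x. norm (b x) \<le> B / (1 + x\<^sup>2)"
    using decaying_line_bound[OF assms(2)] ..
  have "norm (a x + b x) \<le> (A + B) / (1 + x\<^sup>2)" for x
    unfolding add_divide_distrib by (rule norm_triangle_mono[OF A[rule_format] B[rule_format]])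
  moreover have "continuous_on UNIV (\<lambda>x. a x + b x)"
    using assms unfolding decaying_line_def by (intro continuous_intros) auto
  ultimately show ?thesis
    by (rule decaying_lineI[rotated])
qed

lemma has_vector_derivative_modulated:
  assumes "(r has_real_derivative r' x) (at x)"
  shows "((\<lambda>x. c * exp (\<i> * of_real (k * x)) * of_real (r x)) has_vector_derivative
    c * \<i> * of_real k * exp (\<i> * of_real (k * x)) * of_real (r x)
      + c * exp (\<i> * of_real (k * x)) * of_real (r' x)) (at x)"
proof -
  have "((\<lambda>z. c * exp (\<i> * (of_real k * z))) has_field_derivative
      c * \<i> * of_real k * exp (\<i> * (of_real k * of_real x))) (at (of_real x))"
    by (auto intro!: derivative_eq_intros)
  from has_vector_derivative_real_field[OF this]
  have "((\<lambda>x. c * exp (\<i> * of_real (k * x))) has_vector_derivative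
      c * \<i> * of_real k * exp (\<i> * of_real (k * x))) (at x)"
    by simp
  from has_vector_derivative_mult[OF this has_vector_derivative_of_real[OF assms]] show ?thesis
    by (simp add: add.commute)
qed

text \<open>
  The profile \<open>1 / (1 + x\<^sup>2)\<close> keeps its own rate of decay under two differentiations, which is
  exactly what membership in \<open>decaying_fields\<close> demands. The modulation \<open>exp (\<i> k x)\<close> changes none
  of the bounds, except through factors \<open>k\<close> and \<open>k\<^sup>2\<close>.
\<close>

lemma modulated_profile:
  obtains a' a'' where
    "\<And>x. ((\<lambda>x. exp (\<i> * of_real (k * x)) * of_real (1 / (1 + x\<^sup>2))) has_vector_derivative a' x) (at x)"
    "\<And>x. (a' has_vector_derivative a'' x) (at x)"
    "decaying_line (\<lambda>x. exp (\<i> * of_real (k * x)) * of_real (1 / (1 + x\<^sup>2)))"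
    "decaying_line a'" "decaying_line a''"
proof -
  define r where "r x = 1 / (1 + x\<^sup>2)" for x :: real
  define r' where "r' x = - 2 * x / (1 + x\<^sup>2)\<^sup>2" for x :: real
  define r'' where "r'' x = (6 * x\<^sup>2 - 2) / (1 + x\<^sup>2)^3" for x :: real
  have pos: "0 < 1 + x\<^sup>2" for x :: real
    by (simp add: add_pos_nonneg)
  then have nz: "1 + x\<^sup>2 \<noteq> 0" for x :: real
    by (metis less_irrefl)
  have dr: "(r has_real_derivative r' x) (at x)" for x
    unfolding r_def r'_def using nz[of x]
    by (auto intro!: derivative_eq_intros simp: power2_eq_square)
  have dr': "(r' has_real_derivative r'' x) (at x)" for x
    unfolding r'_def r''_def using nz[of x]
    by (auto intro!: derivative_eq_intros simp: field_simps; simp add: algebra_simps power_def eval_nat_numeral)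
  have cont: "continuous_on UNIV r" "continuous_on UNIV r'" "continuous_on UNIV r''"
    unfolding r_def r'_def r''_def using nz by (auto intro!: continuous_intros)
  have b: "\<bar>r x\<bar> \<le> 1 / (1 + x\<^sup>2)" for x
    using pos[of x] by (simp add: r_def)
  have b': "\<bar>r' x\<bar> \<le> 1 / (1 + x\<^sup>2)" for x
  proof -
    have "0 \<le> (\<bar>x\<bar> - 1)\<^sup>2" by simp
    then have "2 * \<bar>x\<bar> \<le> 1 + x\<^sup>2" by (simp add: power2_diff)
    then have "2 * \<bar>x\<bar> / (1 + x\<^sup>2)\<^sup>2 \<le> (1 + x\<^sup>2) / (1 + x\<^sup>2)\<^sup>2"
      by (rule divide_right_mono) simp
    then show ?thesis
      using pos[of x] by (simp add: r'_def abs_mult power2_eq_square)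
  qed
  have b'': "\<bar>r'' x\<bar> \<le> 6 / (1 + x\<^sup>2)" for x
  proof -
    have "\<bar>6 * x\<^sup>2 - 2\<bar> \<le> 6 * (1 + x\<^sup>2) * 1"
      using zero_le_power2[of x] by (auto simp: abs_le_iff)
    also have "\<dots> \<le> 6 * (1 + x\<^sup>2) * (1 + x\<^sup>2)"
      using pos[of x] by (intro mult_left_mono) auto
    finally have "\<bar>6 * x\<^sup>2 - 2\<bar> / (1 + x\<^sup>2)^3 \<le> 6 * (1 + x\<^sup>2) * (1 + x\<^sup>2) / (1 + x\<^sup>2)^3"
      using pos[of x] by (intro divide_right_mono) auto
    moreover have "6 * y * y / y^3 = 6 / y" if "y \<noteq> 0" for y :: real
      using that by (simp add: power3_eq_cube)
    ultimately have "\<bar>6 * x\<^sup>2 - 2\<bar> / (1 + x\<^sup>2)^3 \<le> 6 / (1 + x\<^sup>2)"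
      using nz[of x] by metis
    then show ?thesis
      using pos[of x] by (simp add: r''_def)
  qed
  let ?E = "\<lambda>x. exp (\<i> * of_real (k * x))" and ?k = "\<i> * of_real k"
  let ?a' = "\<lambda>x. ?k * ?E x * of_real (r x) + 1 * ?E x * of_real (r' x)"
  let ?a'' = "\<lambda>x. (?k * ?k * ?E x * of_real (r x) + ?k * ?E x * of_real (r' x))
    + (?k * ?E x * of_real (r' x) + 1 * ?E x * of_real (r'' x))"
  note line = decaying_line_product[OF cont(1) b] decaying_line_product[OF cont(2) b']
    decaying_line_product[OF cont(3) b'']
  show thesis
  proof (rule that)
    show "((\<lambda>x. ?E x * of_real (1 / (1 + x\<^sup>2))) has_vector_derivative ?a' x) (at x)" for x
      using has_vector_derivative_modulated[where c=1 and k=k and r=r and r'=r', OF dr[of x]]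
      by (simp add: r_def)
    show "(?a' has_vector_derivative ?a'' x) (at x)" for x
      using has_vector_derivative_add[OF
          has_vector_derivative_modulated[where c="?k" and k=k and r=r and r'=r', OF dr[of x]]
          has_vector_derivative_modulated[where c=1 and k=k and r=r' and r'=r'', OF dr'[of x]]]
      by (simp add: mult.assoc)
    show "decaying_line (\<lambda>x. ?E x * of_real (1 / (1 + x\<^sup>2)))"
      using line(1)[of 1 k] by (simp add: r_def)
    show "decaying_line ?a'" "decaying_line ?a''"
      by (intro decaying_line_add line)+
  qed
qed

text \<open>
  Modulating the profiles by the frequencies \<open>kx\<close> and \<open>ky\<close> cancels the Fourier kernel at \<open>(kx, ky)\<close>, so
  the coefficient there is the integral of a positive function.
\<close>

lemma growth_mode:
  obtains u where "u \<in> decaying_fields" "fourier (u 0) kx ky \<noteq> 0"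
    "\<And>t. partial_t u t = (\<lambda>x y. \<nu> * u t x y)"
proof -
  let ?a = "\<lambda>k x. exp (\<i> * of_real (k * x)) * of_real (1 / (1 + x\<^sup>2))"
  let ?u = "separated_mode \<nu> (?a kx) (?a ky)"
  obtain a' a'' where a: "\<And>x. (?a kx has_vector_derivative a' x) (at x)"
    "\<And>x. (a' has_vector_derivative a'' x) (at x)"
    "decaying_line (?a kx)" "decaying_line a'" "decaying_line a''"
    by (rule modulated_profile[of kx]) blast
  obtain b' b'' where b: "\<And>x. (?a ky has_vector_derivative b' x) (at x)"
    "\<And>x. (b' has_vector_derivative b'' x) (at x)"
    "decaying_line (?a ky)" "decaying_line b'" "decaying_line b''"
    by (rule modulated_profile[of ky]) blast
  have u: "?u \<in> decaying_fields"
    by (rule decaying_fields_separated_mode[OF a b])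
  have t: "partial_t ?u t = (\<lambda>x y. \<nu> * ?u t x y)" for t
    unfolding partial_t_def by (intro ext vector_derivative_at has_vector_derivative_separated_mode_t)
  let ?w = "\<lambda>p::real \<times> real. 1 / ((1 + (fst p)\<^sup>2) * (1 + (snd p)\<^sup>2))"
  have "exp (- \<i> * of_real (kx * x + ky * y)) * ?u 0 x y = of_real (?w (x, y))" for x y
  proof -
    have "exp (- \<i> * of_real (kx * x + ky * y)) * (exp (\<i> * of_real (kx * x)) * exp (\<i> * of_real (ky * y))) = 1"
      unfolding exp_add[symmetric] by (simp add: algebra_simps)
    then show ?thesis
      by (simp add: separated_mode_def field_simps)
  qed
  then have "fourier (?u 0) kx ky = (LINT p|lborel. of_real (?w p))"
    unfolding fourier_def by (simp only: prod.collapse)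
  then have "fourier (?u 0) kx ky = of_real (integral\<^sup>L lborel ?w)"
    by (simp only: integral_complex_of_real)
  moreover have "integral\<^sup>L lborel ?w \<noteq> 0"
  proof
    assume "integral\<^sup>L lborel ?w = 0"
    moreover have "AE p in lborel. 0 \<le> ?w p"
      by simp
    ultimately have "AE p in lborel. ?w p = 0"
      using integral_nonneg_eq_0_iff_AE[OF integrable_decay2[of 1]] by simp
    moreover have "?w p \<noteq> 0" for p
      by (simp add: add_nonneg_eq_0_iff)
    ultimately have "AE p::real\<times>real in lborel. False"
      by simp
    then show False
      by (simp add: eventually_False ae_filter_eq_bot_iff)
  qed
  ultimately show thesis
    using that[OF u _ t] by simp
qed

lemma growth_rate_eq: "growth_rate \<beta> \<sigma> kx ky = \<i> * layer_symbol \<beta> \<sigma> kx ky"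
  unfolding growth_rate_def
proof (rule the_equality, rule is_growth_rate_symbol)
  fix \<mu>
  assume \<mu>: "is_growth_rate \<beta> \<sigma> kx ky \<mu>"
  let ?\<nu> = "\<i> * layer_symbol \<beta> \<sigma> kx ky"
  obtain u where u: "u \<in> decaying_fields" and nz: "fourier (u 0) kx ky \<noteq> 0"
    and t: "\<And>t. partial_t u t = (\<lambda>x y. ?\<nu> * u t x y)"
    using growth_mode[of kx ky ?\<nu>] by metis
  have "fourier (corner_layer_lhs \<beta> \<sigma> u 0) kx ky = 0"
    unfolding fourier_corner_layer_lhs[OF u] t fourier_cmult by (simp add: algebra_simps)
  then have "((\<lambda>s. fourier (u s) kx ky) has_vector_derivative \<mu> * fourier (u 0) kx ky) (at 0)"
    "((\<lambda>s. fourier (u s) kx ky) has_vector_derivative ?\<nu> * fourier (u 0) kx ky) (at 0)"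
    using \<mu> is_growth_rate_symbol[of \<beta> \<sigma> kx ky] u unfolding is_growth_rate_def by blast+
  then have "\<mu> * fourier (u 0) kx ky = ?\<nu> * fourier (u 0) kx ky"
    by (rule vector_derivative_unique_at)
  with nz show "\<mu> = ?\<nu>"
    by simp
qed

section \<open>Sign of the growth rate\<close>

text \<open>
  Write \<open>e = exp (\<i> \<pi> / 4)\<close>. The number \<open>w = (1 - e c) / (1 + e \<sigma>)\<close> is a positive multiple of
  \<open>(1 - e c) * (1 + cnj e * \<sigma>)\<close>, whose real part is \<open>1 - c \<sigma> + (\<sigma> - c) / sqrt 2\<close> and whose
  imaginary part is \<open>- (c + \<sigma>) / sqrt 2\<close>. The two hypotheses on \<open>c\<close> thus place \<open>w\<close> in the closed
  fourth quadrant, and \<open>Im (w\<^sup>2) = 2 * Re w * Im w\<close>.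
\<close>

lemma Im_diagonal_nonpos:
  assumes \<sigma>: "0 < \<sigma>" and c: "- \<sigma> \<le> c" and re: "0 \<le> 1 - c * \<sigma> + (\<sigma> - c) / sqrt 2"
  shows "Im ((layer_coeff \<sigma> * (1 - exp (\<i> * of_real pi / 4) * of_real c))\<^sup>2) \<le> 0"
proof -
  define h where "h = sqrt 2 / 2"
  have h: "0 < h" "h * h = 1 / 2" "1 / sqrt 2 = h"
    by (simp_all add: h_def real_div_sqrt divide_simps)
  have e: "exp (\<i> * of_real pi / 4) = Complex h h"
  proof -
    have "exp (\<i> * of_real pi / 4) = cis (pi / 4)"
      by (simp add: cis_conv_exp)
    then show ?thesis
      by (simp add: complex_eq_iff cos_45 sin_45 h_def)
  qed
  define d where "d = 1 + exp (\<i> * of_real pi / 4) * of_real \<sigma>"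
  define n where "n = 1 - exp (\<i> * of_real pi / 4) * of_real c"
  have d: "Re d = 1 + h * \<sigma>" "Im d = h * \<sigma>" and n: "Re n = 1 - h * c" "Im n = - h * c"
    by (simp_all add: d_def n_def e)
  have hh: "h * \<sigma> * (h * c) = \<sigma> * c / 2"
    using h(2) by (metis (no_types, lifting) mult.assoc mult.commute mult.left_commute times_divide_eq_left mult_1)
  have "Re (n * cnj d) = 1 - c * \<sigma> + h * (\<sigma> - c)"
    using hh by (simp add: d n algebra_simps)
  also have "h * (\<sigma> - c) = (\<sigma> - c) / sqrt 2"
    by (simp add: h(3)[symmetric])
  finally have Re: "0 \<le> Re (n * cnj d)"
    using re by simp
  have "Im (n * cnj d) = - h * (c + \<sigma>)"
    by (simp add: d n algebra_simps)
  then have Im: "Im (n * cnj d) \<le> 0"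
    using h(1) c by (simp add: mult_nonneg_nonneg)
  have "layer_coeff \<sigma> * n = n / d"
    unfolding layer_coeff_def d_def[symmetric] by simp
  also have "\<dots> = n * cnj d / of_real ((cmod d)\<^sup>2)"
    by (rule complex_div_cnj)
  finally have q: "layer_coeff \<sigma> * n = of_real (1 / (cmod d)\<^sup>2) * (n * cnj d)"
    by simp
  have "Re (layer_coeff \<sigma> * n) = 1 / (cmod d)\<^sup>2 * Re (n * cnj d)"
    "Im (layer_coeff \<sigma> * n) = 1 / (cmod d)\<^sup>2 * Im (n * cnj d)"
    unfolding q by simp_all
  then have "0 \<le> Re (layer_coeff \<sigma> * n)" "Im (layer_coeff \<sigma> * n) \<le> 0"
    using Re Im by (simp_all add: divide_nonpos_nonneg)
  then show ?thesis
    unfolding n_def[symmetric] by (simp add: power2_eq_square mult_nonneg_nonpos mult_nonpos_nonneg)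
qed

text \<open>
  In the coordinates \<open>kx + ky\<close> and \<open>kx - ky\<close> the quadratic form has no mixed term: the operators \<open>D\<^sub>x\<close>
  and \<open>D\<^sub>y\<close> are exchanged by swapping \<open>x\<close> and \<open>y\<close>, so that their sum and difference act on each diagonal
  direction separately, and the form itself is invariant under this exchange.
\<close>

lemma layer_symbol_diagonal:
  "layer_symbol \<beta> \<sigma> kx ky =
    - (of_real ((2 + \<beta>) * (kx + ky)\<^sup>2 / 4) * (layer_coeff \<sigma> * (1 - layer_skew \<beta> \<sigma>))\<^sup>2
     + of_real ((2 - \<beta>) * (kx - ky)\<^sup>2 / 4) * (layer_coeff \<sigma> * (1 + layer_skew \<beta> \<sigma>))\<^sup>2)"
proof -
  let ?A = "layer_coeff \<sigma>" and ?g = "layer_skew \<beta> \<sigma>"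
  let ?P = "?A * (1 - ?g) * (of_real (kx + ky) / 2)" and ?Q = "?A * (1 + ?g) * (of_real (kx - ky) / 2)"
  have X: "?A * (\<i> * of_real kx - ?g * (\<i> * of_real ky)) = \<i> * (?P + ?Q)"
    and Y: "?A * (\<i> * of_real ky - ?g * (\<i> * of_real kx)) = \<i> * (?P - ?Q)"
    by (simp_all add: field_simps)
  have id: "(\<i> * (P + Q))\<^sup>2 + (\<i> * (P - Q))\<^sup>2 + b * (\<i> * (P + Q)) * (\<i> * (P - Q))
    = - ((2 + b) * P\<^sup>2 + (2 - b) * Q\<^sup>2)" for P Q b :: complex
    by (simp add: power2_eq_square algebra_simps)
  show ?thesis
    unfolding layer_symbol_def Let_def X Y id by (simp add: power_mult_distrib power_divide mult_ac)
qed

text \<open>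
  For \<open>b > 0\<close>, \<open>sigma1 b\<close> is the positive root of
  \<open>b \<sigma>\<^sup>2 / 2 - (1 - b / 2) \<sigma> / sqrt 2 = 1\<close>. For \<open>b = 0\<close> the left-hand side of the inequality is negative.
\<close>

lemma sigma1_quadratic:
  assumes b: "0 \<le> b" and \<sigma>: "0 < \<sigma>" and less: "ereal \<sigma> < sigma1 b"
  shows "b * \<sigma>\<^sup>2 / 2 - (1 - b / 2) * \<sigma> / sqrt 2 \<le> 1"
proof (cases "b = 0")
  case True
  with \<sigma> show ?thesis by (simp add: order_trans[of _ 0])
next
  case False
  with b have b: "0 < b" by simp
  define D where "D = b\<^sup>2 + 12 * b + 4"
  have D: "(2 - b)\<^sup>2 \<le> D"
    using b by (simp add: D_def power2_diff)
  have D0: "0 \<le> D"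
    using b by (simp add: D_def)
  \<comment> \<open>In the variable \<open>z\<close> the roots of the quadratic are \<open>2 - b \<plusminus> sqrt D\<close>.\<close>
  define z where "z = 2 * sqrt 2 * b * \<sigma>"
  have "\<sigma> < sqrt 2 / (4 * b) * (2 - b + sqrt D)"
    using less False by (simp add: sigma1_def D_def)
  then have "2 * sqrt 2 * b * \<sigma> < 2 * sqrt 2 * b * (sqrt 2 / (4 * b) * (2 - b + sqrt D))"
    using b by (intro mult_strict_left_mono) auto
  also have "\<dots> = 2 - b + sqrt D"
    using b by (simp add: field_simps)
  finally have up: "z - (2 - b) \<le> sqrt D"
    by (simp add: z_def)
  have "- sqrt D \<le> - \<bar>2 - b\<bar>"
    using real_le_rsqrt[of "\<bar>2 - b\<bar>" D] D by simp
  moreover have "0 < z"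
    using b \<sigma> by (simp add: z_def)
  ultimately have "- sqrt D \<le> z - (2 - b)"
    by (simp add: abs_if split: if_splits)
  with up have "\<bar>z - (2 - b)\<bar> \<le> sqrt D"
    by (simp add: abs_le_iff)
  then have "(z - (2 - b))\<^sup>2 \<le> D"
    using D0 by (metis abs_ge_zero power2_abs power_mono real_sqrt_pow2)
  then have quad: "z\<^sup>2 - 2 * (2 - b) * z \<le> 16 * b"
    by (simp add: D_def power2_diff algebra_simps power2_eq_square)
  define s where "s = \<sigma> / sqrt 2"
  then have "\<sigma> = s * sqrt 2"
    by simp
  then have z: "z = 4 * b * s" "z\<^sup>2 = 8 * b\<^sup>2 * \<sigma>\<^sup>2"
    by (simp_all add: z_def power_mult_distrib)
  have "16 * b * (b * \<sigma>\<^sup>2 / 2 - (1 - b / 2) * s) \<le> 16 * b * 1"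
    using quad unfolding z(2) unfolding z(1) by (simp add: algebra_simps power2_eq_square)
  then show ?thesis
    using b by (simp add: mult_le_cancel_left_pos s_def)
qed

text \<open>
  The two diagonal coefficients of the symbol are the cases \<open>c = \<beta> \<sigma> / 2\<close> and \<open>c = - \<beta> \<sigma> / 2\<close> of the
  sign lemma. The larger of the two, \<open>c = \<bar>\<beta>\<bar> \<sigma> / 2\<close>, makes the real part smallest, and there the
  requirement on the real part is the quadratic inequality satisfied below \<open>sigma1 \<bar>\<beta>\<bar>\<close>.
\<close>

lemma stable_below_sigma1:
  assumes \<beta>: "\<bar>\<beta>\<bar> < 1" and \<sigma>: "0 < \<sigma>" and less: "ereal \<sigma> < sigma1 \<bar>\<beta>\<bar>"
  shows "corner_layer_stable \<beta> \<sigma>"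
proof -
  have diag: "Im ((layer_coeff \<sigma> * (1 - exp (\<i> * of_real pi / 4) * of_real (\<gamma> * \<sigma> / 2)))\<^sup>2) \<le> 0"
    if \<gamma>: "\<bar>\<gamma>\<bar> = \<bar>\<beta>\<bar>" for \<gamma>
  proof (rule Im_diagonal_nonpos[OF \<sigma>])
    have le: "\<gamma> * \<sigma> \<le> \<bar>\<beta>\<bar> * \<sigma>" "- \<gamma> * \<sigma> \<le> \<bar>\<beta>\<bar> * \<sigma>" "\<bar>\<beta>\<bar> * \<sigma> \<le> 1 * \<sigma>"
      using \<gamma> \<beta> \<sigma> by (intro mult_right_mono; simp)+
    then show "- \<sigma> \<le> \<gamma> * \<sigma> / 2"
      using \<sigma> by linarith
    have "\<gamma> * \<sigma> / 2 * \<sigma> \<le> \<bar>\<beta>\<bar> * \<sigma> / 2 * \<sigma>"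
      using le(1) \<sigma> by (intro mult_right_mono) auto
    moreover have "(\<sigma> - \<bar>\<beta>\<bar> * \<sigma> / 2) / sqrt 2 \<le> (\<sigma> - \<gamma> * \<sigma> / 2) / sqrt 2"
      using le(1) by (intro divide_right_mono) auto
    moreover have "\<bar>\<beta>\<bar> * \<sigma> / 2 * \<sigma> - (\<sigma> - \<bar>\<beta>\<bar> * \<sigma> / 2) / sqrt 2 \<le> 1"
      using sigma1_quadratic[OF abs_ge_zero \<sigma> less] by (simp add: power2_eq_square algebra_simps)
    ultimately show "0 \<le> 1 - \<gamma> * \<sigma> / 2 * \<sigma> + (\<sigma> - \<gamma> * \<sigma> / 2) / sqrt 2"
      by linarith
  qed
  have minus: "Im ((layer_coeff \<sigma> * (1 - layer_skew \<beta> \<sigma>))\<^sup>2) \<le> 0"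
    using diag[of \<beta>] by (simp add: layer_skew_def mult.assoc)
  have plus: "Im ((layer_coeff \<sigma> * (1 + layer_skew \<beta> \<sigma>))\<^sup>2) \<le> 0"
    using diag[of "- \<beta>"] by (simp add: layer_skew_def mult.assoc)
  have "Re (growth_rate \<beta> \<sigma> kx ky) \<le> 0" for kx ky
  proof -
    \<comment> \<open>The growth rate is \<open>\<i>\<close> times the symbol, so its real part is minus an imaginary part.\<close>
    have Im_scale: "Im (of_real r * z) = r * Im z" for r z
      by simp
    have "Re (growth_rate \<beta> \<sigma> kx ky) = - Im (layer_symbol \<beta> \<sigma> kx ky)"
      by (simp add: growth_rate_eq)
    also have "\<dots> = (2 + \<beta>) * (kx + ky)\<^sup>2 / 4 * Im ((layer_coeff \<sigma> * (1 - layer_skew \<beta> \<sigma>))\<^sup>2)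
        + (2 - \<beta>) * (kx - ky)\<^sup>2 / 4 * Im ((layer_coeff \<sigma> * (1 + layer_skew \<beta> \<sigma>))\<^sup>2)"
      unfolding layer_symbol_diagonal uminus_complex.sel plus_complex.sel Im_scale by simp
    also have "\<dots> \<le> 0"
      using \<beta> minus plus by (intro add_nonpos_nonpos mult_nonneg_nonpos) auto
    finally show ?thesis .
  qed
  then show ?thesis
    unfolding corner_layer_stable_def by blast
qed

theorem mainTheorem1:
  shows "(\<forall>\<beta> \<sigma> :: real. \<bar>\<beta>\<bar> < 1 \<and> 0 < \<sigma> \<and> ereal \<sigma> < sigma1 \<bar>\<beta>\<bar> \<longrightarrow> corner_layer_stable \<beta> \<sigma>)
    \<and> (\<forall>\<sigma> :: real. 0 < \<sigma> \<longrightarrow> corner_layer_stable 0 \<sigma>)"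
proof (intro conjI allI impI)
  fix \<beta> \<sigma> :: real
  assume "\<bar>\<beta>\<bar> < 1 \<and> 0 < \<sigma> \<and> ereal \<sigma> < sigma1 \<bar>\<beta>\<bar>"
  then show "corner_layer_stable \<beta> \<sigma>"
    by (intro stable_below_sigma1) auto
next
  fix \<sigma> :: real
  assume "0 < \<sigma>"
  then show "corner_layer_stable 0 \<sigma>"
    by (intro stable_below_sigma1) (auto simp: sigma1_def)
qed

end
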